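(* Let $n,w,d\ge1$, $N=2^n$, and let $\mathbb{F}$ be a field with $|\mathbb{F}|>nd$. Let $F\in\mathbb{F}[X_1,\ldots,X_N]$ have individual degree at most $d$ and be computed by a commutative roABP of width $w$. Then $F\not\equiv0$ if and only if $F\circ\mathcal{G}^{\mathrm{SSV}}_{n,1+4\log w}\not\equiv0$.
   Context: Let $P(z_1,\ldots,z_n,x_1,\ldots,x_n)=\prod_{i=1}^n(z_ix_i+(1-z_i))$ and $Q^{\mathrm{SSV}}_{n,k}(y,z,x)=\sum_{j=1}^k y_jP(z_j,x)$ with $z_j=(z_{j,1},\ldots,z_{j,n})$; $\mathcal{G}^{\mathrm{SSV}}_{n,k}(y,z)$ is the coefficient vector of $Q^{\mathrm{SSV}}_{n,k}$ as a multilinear polynomial in $x$, with coordinates indexed by subsets $S\subseteq[n]$ and identified with $X_1,\ldots,X_N$ via $i-1=\sum_{k\in S}2^{k-1}$; $F\circ\mathcal{G}$ denotes substituting coordinate $i$ for $X_i$. A read-once oblivious algebraic branching program (roABP) of width $w$ in variable order $\sigma$ (a permutation of $[N]$) computes $F=\big(\prod_{i=1}^N M_i(X_{\sigma(i)})\big)_{1,1}$ where each $M_i$ is a $w\times w$ matrix whose entries are univariate polynomials in $X_{\sigma(i)}$. $F$ is computed by a width-$w$ commutative roABP if it is computed by a width-$w$ roABP in every variable order. Here $\log$ is base $2$ (taken so that $1+4\log w$ is an integer). *)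

theory Defs
  imports "HOL-Combinatorics.Permutations" "HOL-Library.Poly_Mapping" "HOL-Computational_Algebra.Polynomial"
begin

text \<open>Multivariate polynomials over a coefficient ring 'a in variables of type 'v:
  finitely supported maps from monomials (exponent vectors 'v =>0 nat) to coefficients.
  The ring structure is the convolution ring of HOL-Library.Poly_Mapping.\<close>

type_synonym ('v, 'a) mpoly = "('v \<Rightarrow>\<^sub>0 nat) \<Rightarrow>\<^sub>0 'a"

definition mmonom :: "'a::zero \<Rightarrow> ('v \<Rightarrow>\<^sub>0 nat) \<Rightarrow> ('v, 'a) mpoly" where
  "mmonom c m = Poly_Mapping.single m c"

definition mvar :: "'v \<Rightarrow> ('v, 'a::{zero,one}) mpoly" where
  "mvar v = Poly_Mapping.single (Poly_Mapping.single v 1) 1"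

definition mconst :: "'a::zero \<Rightarrow> ('v, 'a) mpoly" where
  "mconst c = Poly_Mapping.single 0 c"

definition indiv_deg_le :: "('v, 'a::zero) mpoly \<Rightarrow> nat \<Rightarrow> bool" where
  "indiv_deg_le F d \<longleftrightarrow> (\<forall>m \<in> Poly_Mapping.keys F. \<forall>v. Poly_Mapping.lookup m v \<le> d)"

definition upoly_in :: "'v \<Rightarrow> 'a::comm_ring_1 poly \<Rightarrow> ('v, 'a) mpoly" where
  "upoly_in v p = (\<Sum>e\<le>Polynomial.degree p. mconst (coeff p e) * mvar v ^ e)"

definition msubst :: "('v \<Rightarrow> ('u, 'a::comm_ring_1) mpoly) \<Rightarrow> ('v, 'a) mpoly \<Rightarrow> ('u, 'a) mpoly" where
  "msubst g F = (\<Sum>m \<in> Poly_Mapping.keys F.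
      mconst (Poly_Mapping.lookup F m) * (\<Prod>v \<in> Poly_Mapping.keys m. g v ^ Poly_Mapping.lookup m v))"

definition matmul :: "nat \<Rightarrow> (nat \<Rightarrow> nat \<Rightarrow> 'b::comm_semiring_1) \<Rightarrow> (nat \<Rightarrow> nat \<Rightarrow> 'b) \<Rightarrow> nat \<Rightarrow> nat \<Rightarrow> 'b" where
  "matmul w A B = (\<lambda>r c. \<Sum>k<w. A r k * B k c)"

definition matid :: "nat \<Rightarrow> nat \<Rightarrow> 'b::comm_semiring_1" where
  "matid = (\<lambda>r c. if r = c then 1 else 0)"

definition matprod :: "nat \<Rightarrow> (nat \<Rightarrow> nat \<Rightarrow> 'b::comm_semiring_1) list \<Rightarrow> nat \<Rightarrow> nat \<Rightarrow> 'b" where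
  "matprod w Ms = foldr (matmul w) Ms matid"

text \<open>F (in variables X_1..X_N, encoded as naturals 1..N) is computed by a width-w roABP in
  variable order sigma: F = (prod_{i=1}^N M_i(X_{sigma i}))_{1,1}, each M_i a w x w matrix of
  univariate polynomials in X_{sigma i}. Matrix indices are 0-based here, so entry (1,1) is (0,0).\<close>
definition roABP :: "nat \<Rightarrow> nat \<Rightarrow> (nat \<Rightarrow> nat) \<Rightarrow> (nat, 'a::comm_ring_1) mpoly \<Rightarrow> bool" where
  "roABP N w \<sigma> F \<longleftrightarrow>
     (\<exists>M :: nat \<Rightarrow> nat \<Rightarrow> nat \<Rightarrow> 'a poly.
        F = matprod w (map (\<lambda>i. \<lambda>r c. upoly_in (\<sigma> i) (M i r c)) [1..<N+1]) 0 0)"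

definition commutative_roABP :: "nat \<Rightarrow> nat \<Rightarrow> (nat, 'a::comm_ring_1) mpoly \<Rightarrow> bool" where
  "commutative_roABP N w F \<longleftrightarrow> (\<forall>\<sigma>. \<sigma> permutes {1..N} \<longrightarrow> roABP N w \<sigma> F)"

datatype gvar = Y nat | Z nat nat

text \<open>Subset S of [n] corresponding to the coordinate index i in {1..N}: i - 1 = sum_{k in S} 2^(k-1).\<close>
definition subset_of_index :: "nat \<Rightarrow> nat \<Rightarrow> nat set" where
  "subset_of_index n i = {k \<in> {1..n}. odd ((i - 1) div 2 ^ (k - 1))}"

text \<open>Coefficient of prod_{i in S} x_i in Q^SSV_{n,k}(y,z,x) = sum_j y_j prod_i (z_{j,i} x_i + 1 - z_{j,i}).\<close>
definition SSV_coord :: "nat \<Rightarrow> nat \<Rightarrow> nat set \<Rightarrow> (gvar, 'a::comm_ring_1) mpoly" where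
  "SSV_coord n k S = (\<Sum>j = 1..k. mvar (Y j) *
      ((\<Prod>i \<in> S. mvar (Z j i)) * (\<Prod>i \<in> {1..n} - S. 1 - mvar (Z j i))))"

definition SSV_gen :: "nat \<Rightarrow> nat \<Rightarrow> nat \<Rightarrow> (gvar, 'a::comm_ring_1) mpoly" where
  "SSV_gen n k i = SSV_coord n k (subset_of_index n i)"

end

theory Submission
  imports Defs
begin

text \<open>
  Let \<open>L = \<lceil>log w\<rceil>\<close>, and split the \<open>1 + 4L\<close> summands of the generator into \<open>m = 1 + 2L\<close> and \<open>2L\<close>
  summands. The first block is a point \<open>\<alpha>\<close> any \<open>m\<close> of whose coordinates are algebraically
  independent; the second block can turn any \<open>2L\<close> coordinates into free variables. So if the
  composition vanishes, then \<open>F\<close> vanishes at \<open>\<alpha>\<close> with any \<open>2L\<close> coordinates left free.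

  If \<open>F \<noteq> 0\<close>, take a minimal set \<open>T\<close> such that \<open>F\<close> is nonzero at \<open>\<alpha>\<close> with the coordinates in \<open>T\<close> left
  free. It has a subset \<open>T'\<close> of size \<open>m\<close>. Reading the variables in \<open>T'\<close> first shows
  \<open>F = (\<Sum>k<w. g\<^sub>k h\<^sub>k)\<close> with \<open>g\<^sub>k\<close> in the variables \<open>x\<^sub>i\<close>, \<open>i \<in> T'\<close>, and \<open>h\<^sub>k\<close> in the others, so some
  nonzero \<open>p = (\<Sum>k<w. c\<^sub>k g\<^sub>k)\<close> vanishes under each substitution \<open>x\<^sub>i := \<alpha>\<^sub>i\<close>, \<open>i \<in> T'\<close>. By linear
  algebra the \<open>c\<^sub>k\<close> can be taken in the polynomial ring generated by the independent \<open>\<alpha>\<^sub>i\<close>. Regard \<open>p\<close>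
  as a matrix indexed by monomials in \<open>\<alpha>\<close> and in \<open>x\<close>: every substitution condition doubles the size
  of a triangular submatrix with nonzero diagonal, so its rank is at least \<open>2\<^sup>m > w\<close>, a contradiction.
\<close>

abbreviation (input) "lk \<equiv> Poly_Mapping.lookup"
abbreviation (input) "ks \<equiv> Poly_Mapping.keys"
abbreviation (input) "sg \<equiv> Poly_Mapping.single"

section \<open>Evaluation of multivariate polynomials\<close>

text \<open>One interface for the embedding \<open>mconst\<close>, the evaluations
  \<open>meval c g\<close> and their compositions.\<close>

locale unital_hom =
  fixes h :: "'r::comm_ring_1 \<Rightarrow> 's::comm_ring_1"
  assumes hom_add: "h (x + y) = h x + h y"
    and hom_mult: "h (x * y) = h x * h y"
    and hom_one: "h 1 = 1"
begin

lemma hom_zero: "h 0 = 0"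
  using hom_add[of 0 0] by simp

lemma hom_diff: "h (x - y) = h x - h y"
  using hom_add[of "x - y" y] by simp

lemma hom_sum: "h (sum f A) = (\<Sum>x\<in>A. h (f x))"
  by (induction A rule: infinite_finite_induct) (simp_all add: hom_zero hom_add)

lemma hom_prod: "h (prod f A) = (\<Prod>x\<in>A. h (f x))"
  by (induction A rule: infinite_finite_induct) (simp_all add: hom_one hom_mult)

lemma hom_power: "h (x ^ e) = h x ^ e"
  by (induction e) (simp_all add: hom_one hom_mult)

end

lemma unital_hom_comp: "unital_hom f \<Longrightarrow> unital_hom g \<Longrightarrow> unital_hom (\<lambda>x. f (g x))"
  by (simp add: unital_hom_def)

lemma unital_hom_mconst: "unital_hom (mconst :: 'a::comm_ring_1 \<Rightarrow> ('v, 'a) mpoly)"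
  by unfold_locales (simp_all add: mconst_def single_add mult_single)

definition mon_eval :: "('v \<Rightarrow> 'r::comm_ring_1) \<Rightarrow> ('v \<Rightarrow>\<^sub>0 nat) \<Rightarrow> 'r" where
  "mon_eval g m = (\<Prod>v \<in> Poly_Mapping.keys m. g v ^ Poly_Mapping.lookup m v)"

text \<open>Coefficients pass through their own map \<open>c\<close>, so that the target may be a
  ring of polynomials over polynomials, as needed for substitutions that keep some variables
  free.\<close>

definition meval :: "('a::comm_ring_1 \<Rightarrow> 'r::comm_ring_1) \<Rightarrow> ('v \<Rightarrow> 'r) \<Rightarrow> ('v, 'a) mpoly \<Rightarrow> 'r" where
  "meval c g F = (\<Sum>m \<in> Poly_Mapping.keys F. c (Poly_Mapping.lookup F m) * mon_eval g m)"

lemma mon_eval_cong: "(\<And>v. v \<in> ks m \<Longrightarrow> g v = g' v) \<Longrightarrow> mon_eval g m = mon_eval g' m"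
  by (simp add: mon_eval_def)

lemma meval_cong:
  "(\<And>m v. m \<in> ks F \<Longrightarrow> v \<in> ks m \<Longrightarrow> g v = g' v) \<Longrightarrow> meval c g F = meval c g' F"
  by (simp add: meval_def cong: mon_eval_cong)

lemma msubst_eq_meval: "msubst g F = meval mconst g F"
  by (simp add: msubst_def meval_def mon_eval_def)

lemma mon_eval_superset:
  assumes "finite A" "ks m \<subseteq> A"
  shows "mon_eval g m = (\<Prod>v\<in>A. g v ^ lk m v)"
  unfolding mon_eval_def using assms
  by (intro prod.mono_neutral_left) (auto simp: in_keys_iff)

lemma mon_eval_0 [simp]: "mon_eval g 0 = 1"
  by (simp add: mon_eval_def)

lemma mon_eval_add: "mon_eval g (m + m') = mon_eval g m * mon_eval g m'"
proof -
  let ?A = "ks m \<union> ks m'"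
  have "ks (m + m') \<subseteq> ?A" by (rule Poly_Mapping.keys_add)
  then show ?thesis
    by (simp add: mon_eval_superset[of ?A] lookup_add power_add prod.distrib)
qed

lemma mon_eval_single [simp]: "mon_eval g (sg v e) = g v ^ e"
  by (subst mon_eval_superset[of "{v}"]) auto

lemma hom_mon_eval: "unital_hom h \<Longrightarrow> h (mon_eval g m) = mon_eval (\<lambda>v. h (g v)) m"
  by (simp add: mon_eval_def unital_hom.hom_prod unital_hom.hom_power)

lemma sum_single_lookup: "(\<Sum>m\<in>ks F. sg m (lk F m)) = F"
  by (rule poly_mapping_eqI)
     (auto simp: lookup_sum lookup_single when_def sum.delta' in_keys_iff)

lemma meval_superset:
  assumes "c 0 = 0" "finite B" "ks F \<subseteq> B"
  shows "meval c g F = (\<Sum>m\<in>B. c (lk F m) * mon_eval g m)"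
  unfolding meval_def using assms
  by (intro sum.mono_neutral_left) (auto simp: in_keys_iff)

lemma meval_single: "c 0 = 0 \<Longrightarrow> meval c g (sg m a) = c a * mon_eval g m"
  by (subst meval_superset[of _ "{m}"]) auto

lemma meval_add:
  assumes "unital_hom c"
  shows "meval c g (F + G) = meval c g F + meval c g G"
proof -
  interpret unital_hom c by fact
  let ?B = "ks F \<union> ks G"
  have "ks (F + G) \<subseteq> ?B" by (rule Poly_Mapping.keys_add)
  then show ?thesis
    by (simp add: meval_superset[of _ ?B] hom_zero lookup_add hom_add distrib_right sum.distrib)
qed

lemma meval_sum:
  assumes "unital_hom c"
  shows "meval c g (sum f A) = (\<Sum>x\<in>A. meval c g (f x))"
  by (induction A rule: infinite_finite_induct)
     (simp_all add: meval_add[OF assms], simp_all add: meval_def)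

lemma unital_hom_meval:
  assumes "unital_hom c"
  shows "unital_hom (meval c g)"
proof
  interpret unital_hom c by fact
  show "meval c g (F + G) = meval c g F + meval c g G" for F G
    by (rule meval_add[OF assms])
  show "meval c g 1 = 1"
    unfolding single_one[symmetric] by (subst meval_single) (simp_all add: hom_zero hom_one)
  show "meval c g (F * G) = meval c g F * meval c g G" for F G
  proof -
    have "F * G = (\<Sum>m\<in>ks F. \<Sum>m'\<in>ks G. sg (m + m') (lk F m * lk G m'))"
      using arg_cong2[OF sum_single_lookup[of F] sum_single_lookup[of G], of "(*)"]
      by (simp add: sum_product mult_single)
    then have "meval c g (F * G) = (\<Sum>m\<in>ks F. \<Sum>m'\<in>ks G.
        c (lk F m) * c (lk G m') * (mon_eval g m * mon_eval g m'))"
      by (simp add: meval_sum[OF assms] meval_single hom_zero hom_mult mon_eval_add)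
    then show ?thesis
      by (simp add: meval_def sum_product mult_ac)
  qed
qed

lemma hom_meval:
  assumes "unital_hom h"
  shows "h (meval c g F) = meval (\<lambda>x. h (c x)) (\<lambda>v. h (g v)) F"
  using assms
  by (simp add: meval_def unital_hom.hom_sum unital_hom.hom_mult hom_mon_eval)

lemma meval_mconst: "unital_hom c \<Longrightarrow> meval c g (mconst a) = c a"
  by (simp add: mconst_def meval_single unital_hom.hom_zero)

lemma meval_mvar: "unital_hom c \<Longrightarrow> meval c g (mvar v) = g v"
  by (simp add: mvar_def meval_single unital_hom.hom_zero unital_hom.hom_one)

lemma mconst_mult_mvar_power:
  "mconst c * mvar v ^ e = (sg (sg v e) c :: ('v, 'a::comm_ring_1) mpoly)"
proof -
  have "mvar v ^ e = (sg (sg v e) 1 :: ('v, 'a) mpoly)"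
    by (induction e) (simp_all add: mvar_def mult_single single_add[symmetric])
  then show ?thesis by (simp add: mconst_def mult_single)
qed

lemma mon_eval_mvar: "mon_eval mvar m = (sg m 1 :: ('v, 'a::comm_ring_1) mpoly)"
proof -
  have "(\<Prod>v\<in>A. mvar v ^ lk m v) = (sg (\<Sum>v\<in>A. sg v (lk m v)) 1 :: ('v, 'a) mpoly)" for A
    by (induction A rule: infinite_finite_induct)
       (simp_all add: mconst_mult_mvar_power[of 1, unfolded mconst_def, simplified] mult_single)
  then show ?thesis by (simp add: mon_eval_def sum_single_lookup)
qed

lemma meval_mconst_mvar: "meval mconst mvar F = (F :: ('v, 'a::comm_ring_1) mpoly)"
  using sum_single_lookup[of F]
  by (simp add: meval_def mon_eval_mvar mconst_def mult_single)

lemma lookup_mult_single: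
  fixes Q :: "('v, 'a::comm_ring_1) mpoly"
  shows "lk (Q * sg u c) k = (\<Sum>l\<in>ks Q. if l + u = k then lk Q l * c else 0)"
proof -
  have "Q * sg u c = (\<Sum>l\<in>ks Q. sg (l + u) (lk Q l * c))"
    using arg_cong[OF sum_single_lookup[of Q], of "\<lambda>x. x * sg u c"]
    by (simp add: sum_distrib_right mult_single)
  then show ?thesis by (simp add: lookup_sum lookup_single when_def)
qed

lemma lookup_mult_single_add:
  fixes Q :: "('v, 'a::comm_ring_1) mpoly"
  shows "lk (Q * sg u c) (k + u) = lk Q k * c"
  by (auto simp: lookup_mult_single sum.delta in_keys_iff)

lemma lookup_mconst_mult: "lk (mconst c * Q) k = c * lk (Q :: ('v, 'a::comm_ring_1) mpoly) k"
  using lookup_mult_single_add[of Q 0 c k] by (simp add: mconst_def mult.commute)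

section \<open>Linear algebra\<close>

text \<open>Induction on the number of equations: a pivot in equation \<open>w\<close> eliminates
  one unknown together with that equation.\<close>

lemma underdetermined_system_solution:
  fixes v :: "'j \<Rightarrow> nat \<Rightarrow> 'a::field"
  assumes "finite J" "card J > w"
  shows "\<exists>x. (\<exists>j\<in>J. x j \<noteq> 0) \<and> (\<forall>k<w. (\<Sum>j\<in>J. x j * v j k) = 0)"
  using assms
proof (induction w arbitrary: J v)
  case 0
  then show ?case by (intro exI[of _ "\<lambda>_. 1"]) (auto simp: card_gt_0_iff)
next
  case (Suc w)
  show ?case
  proof (cases "\<exists>j\<in>J. v j w \<noteq> 0")
    case False
    from Suc.IH[of J v] Suc.prems obtain x
      where "\<exists>j\<in>J. x j \<noteq> 0" "\<forall>k<w. (\<Sum>j\<in>J. x j * v j k) = 0" by auto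
    with False show ?thesis by (intro exI[of _ x]) (auto simp: less_Suc_eq)
  next
    case True
    then obtain i where i: "i \<in> J" "v i w \<noteq> 0" by blast
    let ?J = "J - {i}"
    let ?v = "\<lambda>j k. v j k - v j w / v i w * v i k"
    have "finite ?J" "card ?J > w" using Suc.prems i by auto
    from Suc.IH[OF this, of ?v] obtain x where x: "\<exists>j\<in>?J. x j \<noteq> 0"
      "\<forall>k<w. (\<Sum>j\<in>?J. x j * ?v j k) = 0" by blast
    \<comment> \<open>The pivot coordinate gets the value that equation \<open>w\<close>
      forces.\<close>
    define y where "y = x(i := - (\<Sum>j\<in>?J. x j * (v j w / v i w)))"
    have "(\<Sum>j\<in>J. y j * v j k) = (\<Sum>j\<in>?J. x j * ?v j k)" for k
    proof -
      have "(\<Sum>j\<in>J. y j * v j k) = y i * v i k + (\<Sum>j\<in>?J. y j * v j k)"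
        using Suc.prems i by (simp add: sum.remove)
      also have "(\<Sum>j\<in>?J. y j * v j k) = (\<Sum>j\<in>?J. x j * v j k)"
        by (rule sum.cong) (auto simp: y_def)
      finally show ?thesis
        by (simp add: y_def sum_distrib_right right_diff_distrib sum_subtractf mult.assoc)
    qed
    moreover have "(\<Sum>j\<in>?J. x j * ?v j w) = 0" using i by simp
    ultimately have "\<forall>k<Suc w. (\<Sum>j\<in>J. y j * v j k) = 0"
      using x(2) by (simp add: less_Suc_eq)
    moreover have "\<exists>j\<in>J. y j \<noteq> 0" using x(1) by (auto simp: y_def)
    ultimately show ?thesis by blast
  qed
qed

text \<open>The matrix of these sums factors through dimension \<open>w\<close>, yet it is
  triangular with nonzero diagonal and so has rank \<open>K\<close>. Concretely, a dependency
  between the vectors \<open>x j\<close> is paired with \<open>y i\<close>, where \<open>z i\<close>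
  is its first nonzero coefficient.\<close>

lemma triangular_le_rank:
  fixes x y :: "nat \<Rightarrow> nat \<Rightarrow> 'a::field"
  assumes diag: "\<And>i. i < K \<Longrightarrow> (\<Sum>k<w. x i k * y i k) \<noteq> 0"
    and tri: "\<And>i j. j < i \<Longrightarrow> i < K \<Longrightarrow> (\<Sum>k<w. x i k * y j k) = 0"
  shows "K \<le> w"
proof (rule ccontr)
  assume "\<not> K \<le> w"
  then obtain z where z: "\<exists>j\<in>{..<K}. z j \<noteq> 0" "\<forall>k<w. (\<Sum>j<K. z j * x j k) = 0"
    using underdetermined_system_solution[of "{..<K}" w x] by auto
  define i where "i = (LEAST j. j < K \<and> z j \<noteq> 0)"
  have i: "i < K" "z i \<noteq> 0"
    using z(1) LeastI_ex[of "\<lambda>j. j < K \<and> z j \<noteq> 0"] by (auto simp: i_def)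
  have z0: "z j = 0" if "j < i" for j
    using not_less_Least[of j "\<lambda>j. j < K \<and> z j \<noteq> 0"] that i by (auto simp: i_def)
  have "(\<Sum>j<K. z j * (\<Sum>k<w. x j k * y i k)) = (\<Sum>k<w. (\<Sum>j<K. z j * x j k) * y i k)"
    by (simp add: sum_distrib_left sum_distrib_right mult.assoc) (rule sum.swap)
  also have "\<dots> = 0" using z(2) by simp
  also have "(\<Sum>j<K. z j * (\<Sum>k<w. x j k * y i k)) = (\<Sum>j\<in>{i}. z j * (\<Sum>k<w. x j k * y i k))"
    using i z0 tri by (intro sum.mono_neutral_right) (auto simp: neq_iff)
  finally show False using i diag by simp
qed

text \<open>Gaussian elimination without division.\<close>

lemma solution_descends_to_subdomain:
  fixes \<phi> :: "'d::idom \<Rightarrow> 'r::idom" and V :: "(nat \<Rightarrow> 'd) set"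
  assumes "unital_hom \<phi>" "inj \<phi>"
    and "\<And>v. v \<in> V \<Longrightarrow> (\<Sum>k<w. c k * \<phi> (v k)) = 0"
    and "(\<Sum>k<w. c k * \<phi> (r k)) \<noteq> 0"
  shows "\<exists>c'. (\<forall>v\<in>V. (\<Sum>k<w. c' k * v k) = 0) \<and> (\<Sum>k<w. c' k * r k) \<noteq> 0"
  using assms(3,4)
proof (induction w arbitrary: V r)
  case 0
  then show ?case by simp
next
  case (Suc w)
  interpret unital_hom \<phi> by fact
  have \<phi>0: "\<phi> x = 0 \<longleftrightarrow> x = 0" for x
    using \<open>inj \<phi>\<close> hom_zero by (metis injD)
  show ?case
  proof (cases "\<exists>v\<in>V. v w \<noteq> 0")
    case False
    show ?thesis
    proof (cases "r w = 0")
      case True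
      obtain c' where "\<forall>v\<in>V. (\<Sum>k<w. c' k * v k) = 0" "(\<Sum>k<w. c' k * r k) \<noteq> 0"
        using Suc.IH[of V r] Suc.prems False True by (force simp: hom_zero)
      then show ?thesis using False True by (intro exI[of _ c']) auto
    next
      case nz: False
      \<comment> \<open>All vectors of \<open>V\<close> vanish at coordinate \<open>w\<close>, so
        the unit vector there works.\<close>
      with False show ?thesis
        by (intro exI[of _ "\<lambda>k. if k = w then 1 else 0"]) auto
    qed
  next
    case True
    then obtain u where u: "u \<in> V" "u w \<noteq> 0" by blast
    \<comment> \<open>Cross-multiplied elimination of coordinate \<open>w\<close> with pivot
      \<open>u\<close>, so that all entries stay in the subdomain.\<close>
    define red where "red = (\<lambda>v k. u w * v k - v w * u k)"
    have eq: "(\<Sum>k<w. c k * \<phi> (red v k)) = \<phi> (u w) * (\<Sum>k<Suc w. c k * \<phi> (v k))" for v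
    proof -
      have "(\<Sum>k<w. c k * \<phi> (red v k)) = (\<Sum>k<Suc w. c k * \<phi> (red v k))"
        by (simp add: red_def hom_zero mult.commute)
      also have "\<dots> = \<phi> (u w) * (\<Sum>k<Suc w. c k * \<phi> (v k)) - \<phi> (v w) * (\<Sum>k<Suc w. c k * \<phi> (u k))"
        unfolding red_def hom_diff hom_mult sum_distrib_left sum_subtractf[symmetric]
        by (rule sum.cong) (simp_all add: algebra_simps)
      finally show ?thesis using Suc.prems(1)[OF u(1)] by simp
    qed
    have "(\<Sum>k<w. c k * \<phi> (v k)) = 0" if "v \<in> red ` V" for v
      using that Suc.prems(1) eq by auto
    moreover have "(\<Sum>k<w. c k * \<phi> (red r k)) \<noteq> 0"
      using Suc.prems(2) u(2) by (simp add: eq \<phi>0)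
    ultimately obtain c' where c': "\<forall>v\<in>red ` V. (\<Sum>k<w. c' k * v k) = 0"
      "(\<Sum>k<w. c' k * red r k) \<noteq> 0"
      using Suc.IH[of "red ` V" "red r"] by blast
    \<comment> \<open>Back-substitution, scaled by \<open>u w\<close> to clear denominators.\<close>
    define c'' where "c'' = (\<lambda>k. if k < w then u w * c' k else - (\<Sum>k<w. c' k * u k))"
    have "(\<Sum>k<Suc w. c'' k * v k) = (\<Sum>k<w. c' k * red v k)" for v
      by (simp add: c''_def red_def right_diff_distrib sum_subtractf sum_distrib_left
          sum_distrib_right mult_ac)
    with c' show ?thesis by (intro exI[of _ c'']) auto
  qed
qed

section \<open>Exponent vectors\<close>

text \<open>The antidiagonal sums are the coefficients left when the variable \<open>i\<close> of
  the rows \<open>b\<close> is identified with that of the columns \<open>a\<close>. Induction on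
  \<open>T\<close>: the entries are grouped into blocks by the two exponents of \<open>i\<close>.
  Two nonzero blocks can be chosen such that the block in the rows of the second and the columns of
  the first is zero; stacking their triangular systems doubles the size.\<close>

lemma triangular_system_of_vanishing:
  fixes p :: "('v \<Rightarrow>\<^sub>0 nat) \<Rightarrow> ('v \<Rightarrow>\<^sub>0 nat) \<Rightarrow> 'a::comm_monoid_add"
  assumes "finite T" "finite {(b, a). p b a \<noteq> 0}"
    and "\<And>i b a s. i \<in> T \<Longrightarrow> lk b i = 0 \<Longrightarrow> lk a i = 0 \<Longrightarrow>
      (\<Sum>t\<le>s. p (b + sg i t) (a + sg i (s - t))) = 0"
    and "\<exists>b a. p b a \<noteq> 0"
  shows "\<exists>(bs :: nat \<Rightarrow> _) as. (\<forall>i < 2 ^ card T. p (bs i) (as i) \<noteq> 0) \<and>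
    (\<forall>i < 2 ^ card T. \<forall>j < i. p (bs i) (as j) = 0)"
  using assms
proof (induction T arbitrary: p rule: finite_induct)
  case empty
  then obtain b a where "p b a \<noteq> 0" by blast
  then show ?case by (intro exI[of _ "\<lambda>_. b"] exI[of _ "\<lambda>_. a"]) simp
next
  case (insert i T)
  \<comment> \<open>The block with row exponent \<beta> and column exponent \<alpha> of
    \<open>i\<close>, moved to exponent 0 so that the induction hypothesis applies.\<close>
  define q where "q \<beta> \<alpha> b a =
    (if lk b i = 0 \<and> lk a i = 0 then p (b + sg i \<beta>) (a + sg i \<alpha>) else 0)" for \<beta> \<alpha> b a
  have fin_q: "finite {(b, a). q \<beta> \<alpha> b a \<noteq> 0}" for \<beta> \<alpha>
  proof (rule finite_imageD)
    let ?f = "\<lambda>(b, a). (b + sg i \<beta>, a + sg i \<alpha>)"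
    show "finite (?f ` {(b, a). q \<beta> \<alpha> b a \<noteq> 0})"
      by (rule finite_subset[OF _ insert.prems(1)]) (auto simp: q_def split: if_splits)
    show "inj_on ?f {(b, a). q \<beta> \<alpha> b a \<noteq> 0}" by (auto intro!: inj_onI)
  qed
  have van_q: "(\<Sum>t\<le>s. q \<beta> \<alpha> (b + sg j t) (a + sg j (s - t))) = 0"
    if "j \<in> T" "lk b j = 0" "lk a j = 0" for \<beta> \<alpha> b a j s
  proof -
    have [simp]: "j \<noteq> i" "i \<noteq> j" using that insert.hyps by auto
    show ?thesis
    proof (cases "lk b i = 0 \<and> lk a i = 0")
      case True
      then have "(\<Sum>t\<le>s. q \<beta> \<alpha> (b + sg j t) (a + sg j (s - t))) =
          (\<Sum>t\<le>s. p ((b + sg i \<beta>) + sg j t) ((a + sg i \<alpha>) + sg j (s - t)))"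
        by (simp add: q_def lookup_add lookup_single add_ac)
      also have "\<dots> = 0"
        using that by (intro insert.prems(2)) (auto simp: lookup_add lookup_single)
      finally show ?thesis .
    next
      case False
      then show ?thesis by (auto simp: q_def lookup_add lookup_single intro!: sum.neutral)
    qed
  qed
  have IH: "\<exists>(bs :: nat \<Rightarrow> _) as. (\<forall>j < 2 ^ card T. q \<beta> \<alpha> (bs j) (as j) \<noteq> 0) \<and>
    (\<forall>j < 2 ^ card T. \<forall>l < j. q \<beta> \<alpha> (bs j) (as l) = 0)"
    if "\<exists>b a. q \<beta> \<alpha> b a \<noteq> 0" for \<beta> \<alpha>
    by (rule insert.IH[OF fin_q _ that]) (rule van_q)
  define NZ where "NZ = {(\<beta>, \<alpha>). \<exists>b a. q \<beta> \<alpha> b a \<noteq> 0}"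
  have in_NZ: "(\<beta>, \<alpha>) \<in> NZ"
    if "p (b + sg i \<beta>) (a + sg i \<alpha>) \<noteq> 0" "lk b i = 0" "lk a i = 0" for b a \<beta> \<alpha>
  proof -
    have "q \<beta> \<alpha> b a \<noteq> 0" using that by (simp add: q_def)
    then show ?thesis by (auto simp: NZ_def)
  qed
  have "NZ \<subseteq> (\<lambda>(b, a). (lk b i, lk a i)) ` {(b, a). p b a \<noteq> 0}"
  proof clarify
    fix \<beta> \<alpha> assume "(\<beta>, \<alpha>) \<in> NZ"
    then obtain b a where "lk b i = 0" "lk a i = 0" "p (b + sg i \<beta>) (a + sg i \<alpha>) \<noteq> 0"
      by (auto simp: NZ_def q_def split: if_splits)
    then show "(\<beta>, \<alpha>) \<in> (\<lambda>(b, a). (lk b i, lk a i)) ` {(b, a). p b a \<noteq> 0}"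
      by (intro image_eqI[of _ _ "(b + sg i \<beta>, a + sg i \<alpha>)"]) (auto simp: lookup_add)
  qed
  then have fin_NZ: "finite NZ" using insert.prems(1) finite_surj by blast
  have "NZ \<noteq> {}"
  proof -
    obtain b a where ba: "p b a \<noteq> 0" using insert.prems by blast
    have split: "m = (m - sg i (lk m i)) + sg i (lk m i)" for m :: "'v \<Rightarrow>\<^sub>0 nat"
      by (rule poly_mapping_eqI) (auto simp: lookup_add lookup_minus lookup_single when_def)
    have "(lk b i, lk a i) \<in> NZ"
      by (rule in_NZ[of "b - sg i (lk b i)" _ "a - sg i (lk a i)"])
         (use ba in \<open>auto simp flip: split simp: lookup_minus\<close>)
    then show ?thesis by blast
  qed
  \<comment> \<open>The extremal block has the largest column exponent, and then the largest row
    exponent for that column exponent.\<close>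
  define \<alpha>1 where "\<alpha>1 = Max (snd ` NZ)"
  have \<alpha>1: "\<alpha>1 \<in> snd ` NZ" "\<And>\<beta> \<alpha>. (\<beta>, \<alpha>) \<in> NZ \<Longrightarrow> \<alpha> \<le> \<alpha>1"
  proof -
    show "\<alpha>1 \<in> snd ` NZ" unfolding \<alpha>1_def using fin_NZ \<open>NZ \<noteq> {}\<close> by (intro Max_in) auto
    show "\<alpha> \<le> \<alpha>1" if "(\<beta>, \<alpha>) \<in> NZ" for \<beta> \<alpha>
      unfolding \<alpha>1_def using fin_NZ image_eqI[OF _ that, of \<alpha> snd] by (intro Max_ge) auto
  qed
  define B where "B = {\<beta>. (\<beta>, \<alpha>1) \<in> NZ}"
  have "B \<noteq> {}" using \<alpha>1 by (auto simp: B_def)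
  have "B \<subseteq> fst ` NZ" by (force simp: B_def)
  then have "finite B" using fin_NZ finite_surj by blast
  define \<beta>1 where "\<beta>1 = Max B"
  have \<beta>1: "(\<beta>1, \<alpha>1) \<in> NZ" "\<And>\<beta>. (\<beta>, \<alpha>1) \<in> NZ \<Longrightarrow> \<beta> \<le> \<beta>1"
    using Max_in[OF \<open>finite B\<close> \<open>B \<noteq> {}\<close>] Max_ge[OF \<open>finite B\<close>] by (auto simp: \<beta>1_def B_def)
  obtain b a where ba: "lk b i = 0" "lk a i = 0" "p (b + sg i \<beta>1) (a + sg i \<alpha>1) \<noteq> 0"
    using \<beta>1(1) by (auto simp: NZ_def q_def split: if_splits)
  define s where "s = \<alpha>1 + \<beta>1"
  \<comment> \<open>The antidiagonal sum through the extremal block vanishes, so it meets a second nonzero block.\<close>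
  have "\<exists>t\<le>s. t \<noteq> \<beta>1 \<and> p (b + sg i t) (a + sg i (s - t)) \<noteq> 0"
  proof (rule ccontr)
    assume "\<not> ?thesis"
    then have "(\<Sum>t\<le>s. p (b + sg i t) (a + sg i (s - t))) =
        (\<Sum>t\<in>{\<beta>1}. p (b + sg i t) (a + sg i (s - t)))"
      by (intro sum.mono_neutral_right) (auto simp: s_def)
    then show False using insert.prems(2)[OF insertI1 ba(1,2), of s] ba(3) by (simp add: s_def)
  qed
  then obtain \<beta>2 where \<beta>2: "\<beta>2 \<le> s" "\<beta>2 \<noteq> \<beta>1" "p (b + sg i \<beta>2) (a + sg i (s - \<beta>2)) \<noteq> 0"
    by blast
  define \<alpha>2 where "\<alpha>2 = s - \<beta>2"
  have NZ2: "(\<beta>2, \<alpha>2) \<in> NZ" using in_NZ \<beta>2 ba by (simp add: \<alpha>2_def)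
  \<comment> \<open>The second block cannot have a larger column exponent, so on the same
    antidiagonal its row exponent is larger. In these rows the columns of exponent \<alpha>1 are
    zero by the maximality of \<beta>1.\<close>
  then have "\<beta>2 > \<beta>1" using \<alpha>1(2)[OF NZ2] \<beta>2 by (simp add: \<alpha>2_def s_def)
  then have "(\<beta>2, \<alpha>1) \<notin> NZ" using \<beta>1(2) by force
  then have zero: "p (b + sg i \<beta>2) (a + sg i \<alpha>1) = 0" if "lk b i = 0" "lk a i = 0" for b a
    using in_NZ that by blast
  let ?K = "2 ^ card T :: nat"
  obtain bs1 as1 where tri1 [rule_format]: "\<forall>j<?K. q \<beta>1 \<alpha>1 (bs1 j) (as1 j) \<noteq> 0"
    "\<forall>j<?K. \<forall>l<j. q \<beta>1 \<alpha>1 (bs1 j) (as1 l) = 0"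
    using IH[of \<beta>1 \<alpha>1] \<beta>1(1) by (auto simp: NZ_def)
  obtain bs2 as2 where tri2 [rule_format]: "\<forall>j<?K. q \<beta>2 \<alpha>2 (bs2 j) (as2 j) \<noteq> 0"
    "\<forall>j<?K. \<forall>l<j. q \<beta>2 \<alpha>2 (bs2 j) (as2 l) = 0"
    using IH[of \<beta>2 \<alpha>2] NZ2 by (auto simp: NZ_def)
  have 0: "lk (bs1 j) i = 0" "lk (as1 j) i = 0" "lk (bs2 j) i = 0" "lk (as2 j) i = 0"
    if "j < ?K" for j
    using tri1(1)[OF that] tri2(1)[OF that] by (auto simp: q_def split: if_splits)
  \<comment> \<open>The extremal block comes first, so \<open>zero\<close> covers later rows against
    earlier columns.\<close>
  define bs where "bs j = (if j < ?K then bs1 j + sg i \<beta>1 else bs2 (j - ?K) + sg i \<beta>2)" for j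
  define as where "as j = (if j < ?K then as1 j + sg i \<alpha>1 else as2 (j - ?K) + sg i \<alpha>2)" for j
  have card: "2 ^ card (insert i T) = ?K + ?K" using insert.hyps by simp
  have "p (bs j) (as j) \<noteq> 0" if "j < ?K + ?K" for j
    using tri1(1)[of j] tri2(1)[of "j - ?K"] 0[of j] 0[of "j - ?K"] that
    by (auto simp: bs_def as_def q_def)
  moreover have "p (bs j) (as l) = 0" if "j < ?K + ?K" "l < j" for j l
  proof -
    consider "j < ?K" | "j \<ge> ?K" "l < ?K" | "l \<ge> ?K" by linarith
    then show ?thesis
    proof cases
      case 1
      then show ?thesis using \<open>l < j\<close> tri1(2)[of j l] 0[of j] 0[of l]
        by (auto simp: bs_def as_def q_def)
    next
      case 2
      then show ?thesis using that 0[of "j - ?K"] 0[of l]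
        by (auto simp: bs_def as_def intro!: zero)
    next
      case 3
      then show ?thesis using that tri2(2)[of "j - ?K" "l - ?K"] 0[of "j - ?K"] 0[of "l - ?K"]
        by (auto simp: bs_def as_def q_def)
    qed
  qed
  ultimately show ?case unfolding card by blast
qed

section \<open>Restrictions and boxes of exponent vectors\<close>

lemma lookup_outside: "ks m \<subseteq> A \<Longrightarrow> v \<notin> A \<Longrightarrow> lk m v = 0"
  by (auto simp: in_keys_iff)

definition mrestrict :: "'v set \<Rightarrow> ('v \<Rightarrow>\<^sub>0 nat) \<Rightarrow> ('v \<Rightarrow>\<^sub>0 nat)" where
  "mrestrict A m = (\<Sum>v \<in> Poly_Mapping.keys m \<inter> A. Poly_Mapping.single v (Poly_Mapping.lookup m v))"

lemma lookup_mrestrict: "lk (mrestrict A m) v = (if v \<in> A then lk m v else 0)"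
  by (auto simp: mrestrict_def lookup_sum lookup_single when_def sum.delta in_keys_iff)

lemma keys_mrestrict: "ks (mrestrict A m) = ks m \<inter> A"
  by (auto simp: in_keys_iff lookup_mrestrict split: if_splits)

lemma mrestrict_add:
  assumes "A \<inter> B = {}" "ks m \<subseteq> A \<union> B"
  shows "mrestrict A m + mrestrict B m = m"
  using assms by (intro poly_mapping_eqI) (auto simp: lookup_add lookup_mrestrict in_keys_iff)

text \<open>A summation range independent of the polynomial, finite for finite \<open>A\<close>,
  that factors along disjoint sets of variables.\<close>

definition box :: "'v set \<Rightarrow> nat \<Rightarrow> ('v \<Rightarrow>\<^sub>0 nat) set" where
  "box A d = {u. Poly_Mapping.keys u \<subseteq> A \<and> (\<forall>v. Poly_Mapping.lookup u v \<le> d)}"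

lemma bij_betw_box_add:
  assumes "A \<inter> B = {}"
  shows "bij_betw (\<lambda>(u, u'). u + u') (box A d \<times> box B d) (box (A \<union> B) d)"
proof (rule bij_betw_byWitness[where f' = "\<lambda>m. (mrestrict A m, mrestrict B m)"])
  show "\<forall>x\<in>box A d \<times> box B d. (\<lambda>m. (mrestrict A m, mrestrict B m)) (case x of (u, u') \<Rightarrow> u + u') = x"
  proof clarify
    fix u u' assume "u \<in> box A d" "u' \<in> box B d"
    then have "lk u v = 0 \<or> v \<in> A \<and> v \<notin> B" "lk u' v = 0 \<or> v \<in> B \<and> v \<notin> A" for v
      using assms lookup_outside[of u A v] lookup_outside[of u' B v] unfolding box_def by blast+
    then show "mrestrict A (u + u') = u \<and> mrestrict B (u + u') = u'"
      by (metis (no_types, opaque_lifting) add_0 add.right_neutral lookup_add lookup_mrestrict poly_mapping_eqI)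
  qed
  show "\<forall>m\<in>box (A \<union> B) d. (case (mrestrict A m, mrestrict B m) of (u, u') \<Rightarrow> u + u') = m"
    using mrestrict_add[OF assms] by (auto simp: box_def)
  have "u + u' \<in> box (A \<union> B) d" if uu': "u \<in> box A d" "u' \<in> box B d" for u u'
  proof -
    have "lk u v + lk u' v \<le> d" for v
    proof (cases "v \<in> A")
      case True
      then have "lk u' v = 0" using uu' assms by (auto simp: box_def in_keys_iff)
      then show ?thesis using uu' by (simp add: box_def)
    next
      case False
      then have "lk u v = 0" using uu' by (auto simp: box_def in_keys_iff)
      then show ?thesis using uu' by (simp add: box_def)
    qed
    then show ?thesis
      using uu' Poly_Mapping.keys_add[of u u'] by (auto simp: box_def lookup_add)
  qed
  then show "(\<lambda>(u, u'). u + u') ` (box A d \<times> box B d) \<subseteq> box (A \<union> B) d" by auto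
  show "(\<lambda>m. (mrestrict A m, mrestrict B m)) ` box (A \<union> B) d \<subseteq> box A d \<times> box B d"
    by (auto simp: box_def keys_mrestrict lookup_mrestrict)
qed

lemma box_singleton: "box {i} d = sg i ` {..d}"
proof
  show "box {i} d \<subseteq> sg i ` {..d}"
  proof
    fix u assume u: "u \<in> box {i} d"
    then have "u = sg i (lk u i)"
      by (intro poly_mapping_eqI) (auto simp: box_def lookup_single when_def in_keys_iff)
    with u show "u \<in> sg i ` {..d}" by (auto simp: box_def)
  qed
qed (auto simp: box_def lookup_single when_def split: if_splits)

lemma finite_box: "finite A \<Longrightarrow> finite (box A d)"
proof (induction A rule: finite_induct)
  case empty
  have "box {} d = {0 :: 'a \<Rightarrow>\<^sub>0 nat}" by (auto simp: box_def)
  then show ?case by simp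
next
  case (insert i A)
  then show ?case
    using bij_betw_finite[OF bij_betw_box_add[of "{i}" A d]] by (simp add: box_singleton)
qed

lemma sum_box_union:
  assumes "A \<inter> B = {}"
  shows "(\<Sum>m\<in>box (A \<union> B) d. f m) = (\<Sum>u\<in>box A d. \<Sum>u'\<in>box B d. f (u + u'))"
  by (subst sum.reindex_bij_betw[OF bij_betw_box_add[OF assms], symmetric])
     (simp add: sum.cartesian_product case_prod_beta)

section \<open>Partial evaluation\<close>

text \<open>The coefficient of the monomial with exponent \<open>e\<close> after the variables in \<open>A\<close> have been
  replaced by the values of \<open>g\<close>, for polynomials of individual degree at most \<open>d\<close>.\<close>

definition pcoeff :: "('a \<Rightarrow> 'r) \<Rightarrow> ('v \<Rightarrow> 'r) \<Rightarrow> nat \<Rightarrow> 'v set \<Rightarrow> ('v, 'a::comm_ring_1) mpoly \<Rightarrow>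
    ('v \<Rightarrow>\<^sub>0 nat) \<Rightarrow> 'r::comm_ring_1" where
  "pcoeff c g d A F e = (\<Sum>u\<in>box A d. c (Poly_Mapping.lookup F (e + u)) * mon_eval g u)"

text \<open>Through this recursion, minimality of the set of free variables becomes a linear
  condition for each variable taken out of it.\<close>

lemma pcoeff_insert:
  assumes "i \<notin> A"
  shows "pcoeff c g d (insert i A) F e = (\<Sum>t\<le>d. pcoeff c g d A F (e + sg i t) * g i ^ t)"
proof -
  have "pcoeff c g d ({i} \<union> A) F e =
      (\<Sum>u\<in>box {i} d. \<Sum>u'\<in>box A d. c (lk F (e + (u + u'))) * mon_eval g (u + u'))"
    unfolding pcoeff_def using assms by (intro sum_box_union) auto
  also have "\<dots> = (\<Sum>t\<le>d. \<Sum>u'\<in>box A d. c (lk F (e + (sg i t + u'))) * mon_eval g (sg i t + u'))"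
    unfolding box_singleton by (subst sum.reindex) (auto intro!: inj_onI dest: arg_cong[of _ _ "\<lambda>m. lk m i"])
  finally show ?thesis
    by (simp add: pcoeff_def mon_eval_add sum_distrib_left mult_ac add_ac)
qed

lemma pcoeff_empty: "pcoeff c g d {} (F :: ('v, 'a::comm_ring_1) mpoly) e = c (lk F e)"
proof -
  have "box {} d = {0 :: 'v \<Rightarrow>\<^sub>0 nat}" by (auto simp: box_def)
  then show ?thesis by (simp add: pcoeff_def)
qed

text \<open>Links \<open>pcoeff\<close> to an actual substitution: every monomial splits into a part
  in \<open>T\<close>, which stays free, and a part in \<open>A\<close>, which becomes a
  constant.\<close>

lemma lookup_meval_partial:
  fixes F :: "('v, 'a::comm_ring_1) mpoly" and g :: "'v \<Rightarrow> 'r::comm_ring_1"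
  assumes c: "unital_hom c" and disj: "T \<inter> A = {}" and fin: "finite T" "finite A"
    and F: "ks F \<subseteq> box (T \<union> A) d" and e: "ks e \<subseteq> T"
  shows "lk (meval (\<lambda>a. mconst (c a)) (\<lambda>v. if v \<in> T then mvar v else mconst (g v)) F) e =
    pcoeff c g d A F e"
proof -
  let ?g = "\<lambda>v. if v \<in> T then mvar v else mconst (g v) :: ('v, 'r) mpoly"
  interpret unital_hom c by fact
  interpret mc: unital_hom "mconst :: 'r \<Rightarrow> ('v, 'r) mpoly" by (rule unital_hom_mconst)
  have T: "mon_eval ?g u = sg u 1" if "u \<in> box T d" for u
    using that by (subst mon_eval_mvar[symmetric], intro mon_eval_cong) (auto simp: box_def)
  have A: "mon_eval ?g u = mconst (mon_eval g u)" if "u \<in> box A d" for u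
    unfolding hom_mon_eval[OF unital_hom_mconst]
    using that disj by (intro mon_eval_cong) (auto simp: box_def)
  have "meval (\<lambda>a. mconst (c a)) ?g F = (\<Sum>m\<in>box (T \<union> A) d. mconst (c (lk F m)) * mon_eval ?g m)"
    using F fin by (intro meval_superset) (auto simp: hom_zero mc.hom_zero intro!: finite_box)
  also have "\<dots> = (\<Sum>u\<in>box T d. \<Sum>u'\<in>box A d. mconst (c (lk F (u + u'))) * mon_eval ?g (u + u'))"
    by (rule sum_box_union[OF disj])
  also have "\<dots> = (\<Sum>u\<in>box T d. sg u 1 * mconst (pcoeff c g d A F u))"
    by (intro sum.cong refl)
       (simp add: pcoeff_def mc.hom_sum mc.hom_mult mon_eval_add T A sum_distrib_left mult_ac)
  also have "\<dots> = (\<Sum>u\<in>box T d. sg u (pcoeff c g d A F u))"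
    by (simp add: mconst_def mult_single)
  finally have "lk (meval (\<lambda>a. mconst (c a)) ?g F) e = (if e \<in> box T d then pcoeff c g d A F e else 0)"
    using fin by (simp add: lookup_sum lookup_single when_def finite_box)
  \<comment> \<open>Outside the box, the degree bound makes every contributing coefficient of
    \<open>F\<close> zero.\<close>
  moreover have "pcoeff c g d A F e = 0" if ne: "e \<notin> box T d"
  proof -
    have "lk F (e + u) = 0" for u
    proof -
      obtain v where "lk e v > d" using ne e by (auto simp: box_def not_le)
      then have "lk (e + u) v > d" by (simp add: lookup_add)
      then have "e + u \<notin> box (T \<union> A) d" by (metis (no_types, lifting) box_def mem_Collect_eq leD)
      then show ?thesis using F by (auto simp: in_keys_iff)
    qed
    then show ?thesis by (simp add: pcoeff_def hom_zero)
  qed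
  ultimately show ?thesis by simp
qed

section \<open>Coefficients of read-once branching programs\<close>

lemma lookup_upoly_in_mult:
  fixes Q :: "('v, 'a::comm_ring_1) mpoly"
  assumes Q: "\<And>l. l \<in> ks Q \<Longrightarrow> lk l v = 0" and m: "lk m v = 0"
  shows "lk (upoly_in v p * Q) (m + sg v e) = coeff p e * lk Q m"
proof -
  have summand: "lk (mconst (coeff p e') * mvar v ^ e' * Q) (m + sg v e) =
      (if e' = e then coeff p e * lk Q m else 0)" for e'
  proof (cases "e' = e")
    case True
    then show ?thesis
      using lookup_mult_single_add[of Q "sg v e" "coeff p e" m]
      by (simp add: mconst_mult_mvar_power mult.commute)
  next
    case False
    have "l + sg v e' \<noteq> m + sg v e" if "l \<in> ks Q" for l
    proof
      assume "l + sg v e' = m + sg v e"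
      from arg_cong[OF this, of "\<lambda>x. lk x v"] show False
        using Q[OF that] m False by (simp add: lookup_add)
    qed
    then have "lk (Q * sg (sg v e') (coeff p e')) (m + sg v e) = 0"
      by (simp add: lookup_mult_single)
    with False show ?thesis by (simp add: mconst_mult_mvar_power mult.commute)
  qed
  have "lk (upoly_in v p * Q) (m + sg v e) =
      (\<Sum>e'\<le>degree p. if e' = e then coeff p e * lk Q m else 0)"
    by (simp add: upoly_in_def sum_distrib_right lookup_sum summand)
  also have "\<dots> = coeff p e * lk Q m"
    by (auto simp: coeff_eq_0)
  finally show ?thesis .
qed

text \<open>Each variable is read once, so taking a coefficient commutes with the matrix product: it
  selects one coefficient matrix per factor.\<close>

lemma lookup_matprod_upoly_in:
  fixes M :: "nat \<Rightarrow> nat \<Rightarrow> nat \<Rightarrow> 'a::comm_ring_1 poly"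
  assumes "distinct xs" "inj_on \<sigma> (set xs)"
  shows "lk (matprod w (map (\<lambda>i r c. upoly_in (\<sigma> i) (M i r c)) xs) r c) m =
    (if ks m \<subseteq> \<sigma> ` set xs
     then matprod w (map (\<lambda>i r c. coeff (M i r c) (lk m (\<sigma> i))) xs) r c else 0)"
  using assms
proof (induction xs arbitrary: r c m)
  case Nil
  then show ?case by (auto simp: matprod_def matid_def lookup_one when_def)
next
  case (Cons x xs)
  let ?v = "\<sigma> x"
  let ?Q = "\<lambda>k. matprod w (map (\<lambda>i r c. upoly_in (\<sigma> i) (M i r c)) xs) k c"
  \<comment> \<open>The rest of the monomial once the variable read first is removed.\<close>
  define m0 where "m0 = mrestrict (- {?v}) m"
  have m: "m = m0 + sg ?v (lk m ?v)"
    by (rule poly_mapping_eqI) (auto simp: m0_def lookup_add lookup_mrestrict lookup_single when_def)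
  have m0v: "lk m0 ?v = 0" by (simp add: m0_def lookup_mrestrict)
  have IH: "lk (?Q k) m' = (if ks m' \<subseteq> \<sigma> ` set xs
     then matprod w (map (\<lambda>i r c. coeff (M i r c) (lk m' (\<sigma> i))) xs) k c else 0)" for k m'
    using Cons by simp
  have nv: "?v \<notin> \<sigma> ` set xs" using Cons.prems by auto
  then have Q: "lk l ?v = 0" if "l \<in> ks (?Q k)" for l k
    using that IH[of k l] by (intro lookup_outside[of l "\<sigma> ` set xs"]) (auto simp: in_keys_iff split: if_splits)
  have "lk (upoly_in ?v p * ?Q k) m = coeff p (lk m ?v) * lk (?Q k) m0" for p k
    using lookup_upoly_in_mult[of "?Q k" ?v m0 p "lk m ?v"] Q m0v by (simp flip: m)
  moreover have "lk (?Q k) m0 = (if ks m \<subseteq> \<sigma> ` set (x # xs)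
     then matprod w (map (\<lambda>i r c. coeff (M i r c) (lk m (\<sigma> i))) xs) k c else 0)" for k
  proof -
    have "ks m0 \<subseteq> \<sigma> ` set xs \<longleftrightarrow> ks m \<subseteq> \<sigma> ` set (x # xs)"
      using nv by (auto simp: m0_def keys_mrestrict)
    moreover have "lk m0 (\<sigma> i) = lk m (\<sigma> i)" if "i \<in> set xs" for i
      using nv that by (auto simp: m0_def lookup_mrestrict image_iff)
    then have "map (\<lambda>i r c. coeff (M i r c) (lk m0 (\<sigma> i))) xs =
        map (\<lambda>i r c. coeff (M i r c) (lk m (\<sigma> i))) xs"
      by simp
    ultimately show ?thesis unfolding IH by presburger
  qed
  ultimately show ?case
    by (simp add: matprod_def[of _ "_ # _"] matmul_def lookup_sum flip: matprod_def)
qed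

text \<open>Matrices are functions on all naturals, and \<open>matid\<close> is a left unit only on
  rows below \<open>w\<close>; hence the bound on \<open>r\<close>.\<close>

lemma matprod_append:
  assumes "r < w"
  shows "matprod w (xs @ ys) r c = (\<Sum>k<w. matprod w xs r k * matprod w ys k c)"
  using assms
proof (induction xs arbitrary: r)
  case Nil
  have "(\<Sum>k<w. matprod w [] r k * matprod w ys k c) = (\<Sum>k<w. if k = r then matprod w ys k c else 0)"
    by (intro sum.cong) (auto simp: matprod_def matid_def)
  with Nil show ?case by simp
next
  case (Cons x xs)
  have "matprod w ((x # xs) @ ys) r c = (\<Sum>j<w. x r j * matprod w (xs @ ys) j c)"
    by (simp add: matprod_def matmul_def)
  also have "\<dots> = (\<Sum>j<w. \<Sum>k<w. x r j * (matprod w xs j k * matprod w ys k c))"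
    using Cons.IH by (simp add: sum_distrib_left)
  also have "\<dots> = (\<Sum>k<w. \<Sum>j<w. x r j * (matprod w xs j k * matprod w ys k c))"
    by (rule sum.swap)
  also have "\<dots> = (\<Sum>k<w. matprod w (x # xs) r k * matprod w ys k c)"
    by (simp add: matprod_def matmul_def sum_distrib_right mult.assoc)
  finally show ?case .
qed

text \<open>Supplies a variable order that reads \<open>T\<close> first, by gluing bijections onto
  \<open>T\<close> and onto its complement.\<close>

lemma permutation_with_initial_segment:
  assumes "T \<subseteq> {1..N}"
  shows "\<exists>\<sigma>. \<sigma> permutes {1..N} \<and> \<sigma> ` {1..card T} = T"
proof -
  have "finite T" using assms finite_subset by blast
  have le: "card T \<le> N" using card_mono[OF _ assms] by simp
  obtain f where f: "bij_betw f {1..card T} T"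
    using \<open>finite T\<close> by (metis card_atLeastAtMost diff_Suc_1 finite_atLeastAtMost finite_same_card_bij)
  have "card {card T + 1..N} = card ({1..N} - T)"
    using assms \<open>finite T\<close> by (simp add: card_Diff_subset)
  then obtain g where g: "bij_betw g {card T + 1..N} ({1..N} - T)"
    by (metis finite_Diff finite_atLeastAtMost finite_same_card_bij)
  define \<sigma> where "\<sigma> i = (if i \<in> {1..card T} then f i else if i \<in> {card T + 1..N} then g i else i)" for i
  have "bij_betw \<sigma> {1..card T} T"
    using f by (subst bij_betw_cong[of _ \<sigma> f]) (auto simp: \<sigma>_def)
  moreover have "bij_betw \<sigma> {card T + 1..N} ({1..N} - T)"
    using g by (subst bij_betw_cong[of _ \<sigma> g]) (auto simp: \<sigma>_def)
  ultimately have "bij_betw \<sigma> ({1..card T} \<union> {card T + 1..N}) (T \<union> ({1..N} - T))"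
    by (rule bij_betw_combine) auto
  moreover have "{1..card T} \<union> {card T + 1..N} = {1..N}" using le by auto
  moreover have "T \<union> ({1..N} - T) = {1..N}" using assms by auto
  ultimately have "\<sigma> permutes {1..N}"
    using le by (intro bij_imp_permutes) (auto simp: \<sigma>_def)
  with \<open>bij_betw \<sigma> {1..card T} T\<close> show ?thesis by (auto simp: bij_betw_def)
qed

lemma commutative_roABP_keys:
  assumes "commutative_roABP N w F" "m \<in> ks F"
  shows "ks m \<subseteq> {1..N}"
proof -
  have "roABP N w id F" using assms(1) permutes_id by (auto simp: commutative_roABP_def)
  then obtain M where F: "F = matprod w (map (\<lambda>i r c. upoly_in (id i) (M i r c)) [1..<N + 1]) 0 0"
    unfolding roABP_def by blast
  show ?thesis
    using assms(2) unfolding F in_keys_iff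
    by (subst (asm) lookup_matprod_upoly_in) (auto split: if_splits)
qed

text \<open>In an order that reads \<open>T\<close> first, the product is cut after
  \<open>card T\<close> factors. The prefix sees only \<open>b\<close> and the suffix only
  \<open>e\<close>, so the coefficient matrix of \<open>F\<close> has rank at most
  \<open>w\<close>.\<close>

lemma commutative_roABP_rank_factorization:
  assumes F: "commutative_roABP N w F" and "w \<ge> 1" and T: "T \<subseteq> {1..N}" and d: "indiv_deg_le F d"
  shows "\<exists>g h. (\<forall>b e. ks b \<subseteq> T \<longrightarrow> ks e \<subseteq> {1..N} - T \<longrightarrow>
      lk F (b + e) = (\<Sum>k<w. g k b * h k e)) \<and> (\<forall>k b. b \<notin> box T d \<longrightarrow> g k b = 0)"
proof -
  obtain \<sigma> where \<sigma>: "\<sigma> permutes {1..N}" "\<sigma> ` {1..card T} = T"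
    using permutation_with_initial_segment[OF T] by blast
  then have "roABP N w \<sigma> F" using F by (auto simp: commutative_roABP_def)
  then obtain M where M: "F = matprod w (map (\<lambda>i r c. upoly_in (\<sigma> i) (M i r c)) [1..<N + 1]) 0 0"
    unfolding roABP_def by blast
  define A where "A xs m = matprod w (map (\<lambda>i r c. coeff (M i r c) (lk m (\<sigma> i))) xs)" for xs m
  have A_cong: "A xs m = A xs m'" if "\<And>i. i \<in> set xs \<Longrightarrow> lk m (\<sigma> i) = lk m' (\<sigma> i)" for xs m m'
    unfolding A_def using that by (intro arg_cong[of _ _ "matprod w"] map_cong refl) auto
  let ?xs = "[1..<card T + 1]" and ?ys = "[card T + 1..<N + 1]"
  have "card T \<le> N" using card_mono[OF _ T] by simp
  then have split: "[1..<N + 1] = ?xs @ ?ys"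
    using upt_add_eq_append[of 1 "card T + 1" "N - card T"] by simp
  have inj: "inj \<sigma>" using \<sigma>(1) by (rule permutes_inj)
  have im: "\<sigma> ` set [1..<N + 1] = {1..N}"
    using permutes_image[OF \<sigma>(1)] by (simp only: set_upt Suc_eq_plus1[symmetric] atLeastLessThanSuc_atLeastAtMost)
  have xs: "\<sigma> i \<in> T" if "i \<in> set ?xs" for i
    using \<sigma>(2) that by auto
  have ys: "\<sigma> i \<notin> T" if "i \<in> set ?ys" for i
  proof
    assume "\<sigma> i \<in> T"
    then obtain j where "j \<in> {1..card T}" "\<sigma> j = \<sigma> i" using \<sigma>(2) by (metis imageE)
    then have "i \<in> {1..card T}" using inj by (metis injD)
    then show False using that by auto
  qed
  \<comment> \<open>The matrix entries may have degree above \<open>d\<close>. Cutting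
    \<open>g\<close> off outside the box is harmless because \<open>F\<close> has individual degree
    at most \<open>d\<close>, and it gives \<open>g\<close> finite support.\<close>
  define g where "g k b = (if b \<in> box T d then A ?xs b 0 k else 0)" for k b
  have "lk F (b + e) = (\<Sum>k<w. g k b * A ?ys e k 0)"
    if b: "ks b \<subseteq> T" and e: "ks e \<subseteq> {1..N} - T" for b e
  proof (cases "b \<in> box T d")
    case True
    have "ks (b + e) \<subseteq> {1..N}" using b e T Poly_Mapping.keys_add[of b e] by blast
    moreover have "lk F (b + e) =
        (if ks (b + e) \<subseteq> \<sigma> ` set [1..<N + 1] then A [1..<N + 1] (b + e) 0 0 else 0)"
      unfolding M A_def by (rule lookup_matprod_upoly_in) (auto intro: inj_on_subset[OF inj])
    ultimately have "lk F (b + e) = A [1..<N + 1] (b + e) 0 0"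
      by (simp only: im if_True)
    also have "\<dots> = (\<Sum>k<w. A ?xs (b + e) 0 k * A ?ys (b + e) k 0)"
      unfolding split using \<open>w \<ge> 1\<close> by (simp add: A_def matprod_append)
    also have "A ?xs (b + e) = A ?xs b"
    proof (rule A_cong)
      fix i assume "i \<in> set ?xs"
      then have "lk e (\<sigma> i) = 0" by (intro lookup_outside[OF e]) (use xs in blast)
      then show "lk (b + e) (\<sigma> i) = lk b (\<sigma> i)" by (simp add: lookup_add)
    qed
    also have "A ?ys (b + e) = A ?ys e"
    proof (rule A_cong)
      fix i assume "i \<in> set ?ys"
      then have "lk b (\<sigma> i) = 0" by (intro lookup_outside[OF b] ys)
      then show "lk (b + e) (\<sigma> i) = lk e (\<sigma> i)" by (simp add: lookup_add)
    qed
    finally show ?thesis using True by (simp add: g_def)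
  next
    case False
    then obtain v where "lk b v > d" using b by (auto simp: box_def not_le)
    then have "lk (b + e) v > d" by (simp add: lookup_add)
    then have "lk F (b + e) = 0" using d unfolding indiv_deg_le_def by (metis in_keys_iff leD)
    with False show ?thesis by (simp add: g_def)
  qed
  moreover have "g k b = 0" if "b \<notin> box T d" for k b using that by (simp add: g_def)
  ultimately show ?thesis
    by - (rule exI[of _ g], rule exI[of _ "\<lambda>k e. A ?ys e k 0"], simp)
qed

section \<open>The generator\<close>

text \<open>The subset records the binary digits of \<open>i - 1\<close>, and the digits from
  position \<open>n\<close> on are zero.\<close>

lemma inj_on_subset_of_index: "inj_on (subset_of_index n) {1..2 ^ n}"
proof (rule inj_onI)
  fix i j assume ij: "i \<in> {1..2 ^ n}" "j \<in> {1..2 ^ n}" and eq: "subset_of_index n i = subset_of_index n j"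
  have high: "\<not> odd (x div 2 ^ k)" if "x < 2 ^ n" "n \<le> k" for x k :: nat
    using that by (metis div_less dvd_0_right less_le_trans one_le_numeral power_increasing)
  have "odd ((i - 1) div 2 ^ k) = odd ((j - 1) div 2 ^ k)" for k
  proof (cases "k < n")
    case True
    then have "Suc k \<in> subset_of_index n i \<longleftrightarrow> Suc k \<in> subset_of_index n j" using eq by simp
    with True show ?thesis by (simp add: subset_of_index_def)
  next
    case False
    then show ?thesis using ij high[of "i - 1" k] high[of "j - 1" k] by auto
  qed
  then have "i - 1 = j - 1" by (intro bit_eqI) (simp add: bit_iff_odd)
  with ij show "i = j" by auto
qed

text \<open>At the indicator vector of \<open>S'\<close>, the product P(z, x) collapses to the
  single monomial indexed by \<open>S'\<close>.\<close>

lemma prod_indicator_eq: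
  assumes "S \<subseteq> B" "S' \<subseteq> B" "finite B"
  shows "(\<Prod>l\<in>S. if l \<in> S' then 1 else 0) * (\<Prod>l\<in>B - S. 1 - (if l \<in> S' then 1 else 0)) =
    (if S = S' then 1 else (0 :: 'a::comm_ring_1))"
proof (cases "S = S'")
  case False
  have fin: "finite S" using assms finite_subset by blast
  from False consider l where "l \<in> S" "l \<notin> S'" | l where "l \<in> B - S" "l \<in> S'"
    using assms by blast
  then show ?thesis
  proof cases
    case 1
    then have "(\<Prod>l\<in>S. if l \<in> S' then 1 else 0) = (0 :: 'a)"
      using fin by (intro prod_zero) auto
    then show ?thesis using False by simp
  next
    case 2
    then have "(\<Prod>l\<in>B - S. 1 - (if l \<in> S' then 1 else 0)) = (0 :: 'a)"
      using assms(3) by (intro prod_zero) auto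
    then show ?thesis using False by simp
  qed
qed simp

text \<open>The coefficient at \<open>S\<close> of one summand y P(z, x), for arbitrary ring
  elements in place of the generator variables.\<close>

definition SSV_term :: "nat \<Rightarrow> nat set \<Rightarrow> 'r::comm_ring_1 \<Rightarrow> (nat \<Rightarrow> 'r) \<Rightarrow> 'r" where
  "SSV_term n S y z = y * ((\<Prod>l\<in>S. z l) * (\<Prod>l\<in>{1..n} - S. 1 - z l))"

lemma hom_SSV_gen:
  assumes "unital_hom h"
  shows "h (SSV_gen n k i) =
    (\<Sum>j = 1..k. SSV_term n (subset_of_index n i) (h (mvar (Y j))) (\<lambda>l. h (mvar (Z j l))))"
  using assms
  by (simp add: SSV_gen_def SSV_coord_def SSV_term_def unital_hom.hom_sum unital_hom.hom_mult
      unital_hom.hom_prod unital_hom.hom_diff unital_hom.hom_one)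

lemma SSV_term_indicator:
  assumes "i \<in> {1..2 ^ n}" "i' \<in> {1..2 ^ n}"
  shows "SSV_term n (subset_of_index n i) y (\<lambda>l. if l \<in> subset_of_index n i' then 1 else 0) =
    (if i = i' then y else 0)"
proof -
  have "subset_of_index n i = subset_of_index n i' \<longleftrightarrow> i = i'"
    using assms inj_on_subset_of_index[of n] by (auto simp: inj_on_def)
  moreover have "subset_of_index n i \<subseteq> {1..n}" for i by (auto simp: subset_of_index_def)
  ultimately show ?thesis by (simp add: SSV_term_def prod_indicator_eq)
qed

text \<open>An order on the variables induces one on the monomials, from which polynomials in
  \<open>gvar\<close> inherit the structure of an integral domain.\<close>

instantiation gvar :: linorder
begin

definition less_eq_gvar :: "gvar \<Rightarrow> gvar \<Rightarrow> bool" where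
  "v \<le> v' \<longleftrightarrow> (case (v, v') of (Y j, Y j') \<Rightarrow> j \<le> j' | (Y _, Z _ _) \<Rightarrow> True | (Z _ _, Y _) \<Rightarrow> False
    | (Z j i, Z j' i') \<Rightarrow> j < j' \<or> j = j' \<and> i \<le> i')"

definition less_gvar :: "gvar \<Rightarrow> gvar \<Rightarrow> bool" where
  "v < v' \<longleftrightarrow> v \<le> v' \<and> \<not> v' \<le> (v :: gvar)"

instance
  by standard (auto simp: less_eq_gvar_def less_gvar_def split: gvar.splits)

end

text \<open>Any \<open>m\<close> coordinates of the generator with \<open>m\<close> summands are algebraically independent:
  substituting indicator vectors for the \<open>z\<^sub>j\<close> recovers \<open>y\<^sub>1, \<dots>, y\<^sub>m\<close>.\<close>

lemma SSV_gen_independent: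
  assumes T: "T \<subseteq> {1..2 ^ n}" "card T = m"
  defines "\<gamma> \<equiv> \<lambda>i. if i \<in> T then SSV_gen n m i else (mvar (Y (m + 1 + i)) :: (gvar, 'a::comm_ring_1) mpoly)"
  shows "inj (meval mconst \<gamma>)"
proof -
  have "finite T" using T finite_subset by blast
  obtain s where s: "bij_betw s {1..m} T"
    using \<open>finite T\<close> T(2) by (metis card_atLeastAtMost diff_Suc_1 finite_atLeastAtMost finite_same_card_bij)
  \<comment> \<open>This yields a left inverse: summand \<open>j\<close> contributes to coordinate
    \<open>s j\<close> alone among those in \<open>T\<close>. The variables
    \<open>Y (m + 1 + i)\<close>, which fill the coordinates outside \<open>T\<close>, are shifted
    past those of the generator and mapped back by \<open>j - m - 1\<close>.\<close>
  define \<delta> :: "gvar \<Rightarrow> (nat, 'a) mpoly" where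
    "\<delta> v = (case v of Y j \<Rightarrow> if j \<le> m then mvar (s j) else mvar (j - m - 1)
      | Z j l \<Rightarrow> if l \<in> subset_of_index n (s j) then 1 else 0)" for v
  let ?\<psi> = "meval mconst \<delta>"
  have \<psi>: "unital_hom ?\<psi>" by (intro unital_hom_meval unital_hom_mconst)
  note [simp] = meval_mvar[OF unital_hom_mconst] meval_mconst[OF unital_hom_mconst]
  have "?\<psi> (\<gamma> i) = mvar i" for i
  proof (cases "i \<in> T")
    case True
    have sT: "s j \<in> T" if "j \<in> {1..m}" for j using that s by (auto simp: bij_betw_def)
    obtain j0 where j0: "j0 \<in> {1..m}" "s j0 = i" using True s by (auto simp: bij_betw_def)
    have "?\<psi> (\<gamma> i) = (\<Sum>j = 1..m. SSV_term n (subset_of_index n i) (mvar (s j))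
        (\<lambda>l. if l \<in> subset_of_index n (s j) then 1 else 0))"
      using True by (simp add: \<gamma>_def hom_SSV_gen[OF \<psi>] \<delta>_def)
    also have "\<dots> = (\<Sum>j = 1..m. if i = s j then mvar (s j) else 0)"
      using True T(1) sT by (intro sum.cong refl SSV_term_indicator) blast+
    also have "\<dots> = (\<Sum>j\<in>{j0}. mvar (s j))"
    proof (intro sum.mono_neutral_cong_right)
      show "\<forall>j\<in>{1..m} - {j0}. (if i = s j then mvar (s j) else 0) = 0"
        using j0 inj_onD[OF bij_betw_imp_inj_on[OF s]] by (metis DiffE singletonI)
    qed (use j0 in auto)
    finally show ?thesis using j0 by simp
  next
    case False
    then show ?thesis by (simp add: \<gamma>_def \<delta>_def)
  qed
  then have "?\<psi> (meval mconst \<gamma> p) = p" for p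
    using hom_meval[OF \<psi>, of mconst \<gamma> p] by (simp add: meval_mconst_mvar)
  then show ?thesis by (metis injI)
qed

text \<open>The first \<open>m\<close> summands keep the values of the point; each element of
  \<open>T\<close> costs one further summand, which replaces its value by a free variable.\<close>

lemma pcoeff_SSV_gen_eq_0:
  fixes F :: "(nat, 'a::comm_ring_1) mpoly"
  assumes F: "ks F \<subseteq> box {1..2 ^ n} d" and T: "T \<subseteq> {1..2 ^ n}" "card T \<le> l" and e: "ks e \<subseteq> T"
    and zero: "msubst (SSV_gen n (m + l)) F = 0"
  shows "pcoeff mconst (SSV_gen n m) d ({1..2 ^ n} - T) F e = (0 :: (gvar, 'a) mpoly)"
proof -
  let ?\<alpha> = "SSV_gen n m :: nat \<Rightarrow> (gvar, 'a) mpoly"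
  have finT: "finite T" using T finite_subset by blast
  obtain s where s: "bij_betw s {1..card T} T"
    using finT by (metis card_atLeastAtMost diff_Suc_1 finite_atLeastAtMost finite_same_card_bij)
  \<comment> \<open>Summand \<open>m + j\<close> adds x - \<alpha> at coordinate \<open>s j\<close>
    only, which turns the value \<alpha> there into the variable x. Surplus summands are switched
    off by \<open>Y j\<close> going to 0.\<close>
  define \<theta> :: "gvar \<Rightarrow> (nat, (gvar, 'a) mpoly) mpoly" where
    "\<theta> v = (case v of
        Y j \<Rightarrow> if j \<le> m then mconst (mvar (Y j))
          else if j \<le> m + card T then mvar (s (j - m)) - mconst (?\<alpha> (s (j - m))) else 0
      | Z j i \<Rightarrow> if j \<le> m then mconst (mvar (Z j i))
          else if i \<in> subset_of_index n (s (j - m)) then 1 else 0)" for v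
  let ?c = "\<lambda>a. mconst (mconst a) :: (nat, (gvar, 'a) mpoly) mpoly"
  have c: "unital_hom ?c" by (rule unital_hom_comp[OF unital_hom_mconst unital_hom_mconst])
  have \<theta>: "unital_hom (meval ?c \<theta>)" by (rule unital_hom_meval[OF c])
  note [simp] = meval_mvar[OF c] meval_mconst[OF c]
  have gen: "meval ?c \<theta> (SSV_gen n (m + l) i) = (if i \<in> T then mvar i else mconst (?\<alpha> i))"
    if i: "i \<in> {1..2 ^ n}" for i
  proof -
    let ?t = "\<lambda>j. SSV_term n (subset_of_index n i) (\<theta> (Y j)) (\<lambda>l. \<theta> (Z j l))"
    have "meval ?c \<theta> (SSV_gen n (m + l) i) = (\<Sum>j = 1..m + l. ?t j)"
      by (simp add: hom_SSV_gen[OF \<theta>])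
    also have "{1..m + l} = {1..m} \<union> {m + 1..m + l}" by auto
    also have "(\<Sum>j\<in>{1..m} \<union> {m + 1..m + l}. ?t j) = (\<Sum>j = 1..m. ?t j) + (\<Sum>j = m + 1..m + l. ?t j)"
      by (intro sum.union_disjoint) auto
    also have "(\<Sum>j = 1..m. ?t j) = mconst (?\<alpha> i)"
      by (simp add: hom_SSV_gen[OF unital_hom_mconst] \<theta>_def)
    also have "(\<Sum>j = m + 1..m + l. ?t j) = (\<Sum>j = m + 1..m + card T. ?t j)"
      using T by (intro sum.mono_neutral_right) (auto simp: \<theta>_def SSV_term_def)
    also have "\<dots> = (\<Sum>j = 1..card T. ?t (m + j))"
      by (intro sum.reindex_bij_witness[of _ "\<lambda>j. m + j" "\<lambda>j. j - m"]) auto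
    also have "\<dots> = (\<Sum>j = 1..card T. if i = s j then mvar (s j) - mconst (?\<alpha> (s j)) else 0)"
    proof (intro sum.cong refl)
      fix j assume j: "j \<in> {1..card T}"
      then have "s j \<in> T" using s by (auto simp: bij_betw_def)
      then have sj: "s j \<in> {1..2 ^ n}" using T(1) by blast
      show "?t (m + j) = (if i = s j then mvar (s j) - mconst (?\<alpha> (s j)) else 0)"
        using j by (simp add: \<theta>_def SSV_term_indicator[OF i sj])
    qed
    also have "\<dots> = (\<Sum>v\<in>T. if i = v then mvar v - mconst (?\<alpha> v) else 0)"
      by (rule sum.reindex_bij_betw[OF s])
    also have "\<dots> = (if i \<in> T then mvar i - mconst (?\<alpha> i) else 0)"
      using finT by simp
    finally show ?thesis by simp
  qed
  have "0 = meval ?c \<theta> (meval mconst (SSV_gen n (m + l)) F)"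
    using zero unital_hom.hom_zero[OF \<theta>] by (simp add: msubst_eq_meval)
  also have "\<dots> = meval ?c (\<lambda>i. meval ?c \<theta> (SSV_gen n (m + l) i)) F"
    by (simp add: hom_meval[OF \<theta>])
  also have "\<dots> = meval ?c (\<lambda>i. if i \<in> T then mvar i else mconst (?\<alpha> i)) F"
  proof (rule meval_cong)
    fix x v assume "x \<in> ks F" "v \<in> ks x"
    then have "v \<in> {1..2 ^ n}" using F unfolding box_def by blast
    then show "meval ?c \<theta> (SSV_gen n (m + l) v) = (if v \<in> T then mvar v else mconst (?\<alpha> v))"
      by (rule gen)
  qed
  finally have "meval ?c (\<lambda>i. if i \<in> T then mvar i else mconst (?\<alpha> i)) F = 0" by simp
  moreover have "T \<union> ({1..2 ^ n} - T) = {1..2 ^ n}" using T by auto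
  ultimately show ?thesis
    using lookup_meval_partial[of mconst T "{1..2 ^ n} - T" F d e ?\<alpha>] F e finT unital_hom_mconst by simp
qed

section \<open>The rank argument\<close>

text \<open>Rows are the monomials \<open>b\<close>, columns the monomials of the multipliers
  \<open>c k\<close>, and \<open>mvar i\<close> stands for the value substituted for the variable
  \<open>i\<close>. The sum over \<open>k<w\<close> bounds the rank from above, and
  \<open>van\<close> provides the antidiagonal conditions that bound it from below.\<close>

lemma rank_bound_of_vanishing_combination:
  fixes c :: "nat \<Rightarrow> ('v, 'a::field) mpoly"
  assumes "finite T" and g: "\<And>k b. b \<notin> box T d \<Longrightarrow> g k b = 0"
    and van: "\<And>i b. i \<in> T \<Longrightarrow> ks b \<subseteq> T - {i} \<Longrightarrow>
      (\<Sum>k<w. c k * (\<Sum>t\<le>d. mconst (g k (b + sg i t)) * mvar i ^ t)) = 0"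
    and nz: "(\<Sum>k<w. c k * mconst (g k b0)) \<noteq> 0"
  shows "2 ^ card T \<le> w"
proof -
  define P where "P b = (\<Sum>k<w. c k * mconst (g k b))" for b
  define p where "p b a = lk (P b) a" for b a
  have p: "p b a = (\<Sum>k<w. g k b * lk (c k) a)" for b a
    by (simp add: p_def P_def lookup_sum lookup_mconst_mult mult.commute[of _ "mconst _"])
  have p0: "p b a = 0" if "b \<notin> box T d" for b a using that by (simp add: p g)
  have "{(b, a). p b a \<noteq> 0} \<subseteq> box T d \<times> (\<Union>k<w. ks (c k))"
  proof clarify
    fix b a assume nz: "p b a \<noteq> 0"
    then have "b \<in> box T d" using p0 by blast
    moreover have "\<exists>k<w. lk (c k) a \<noteq> 0"
      using nz sum.neutral[of "{..<w}" "\<lambda>k. g k b * lk (c k) a"] by (auto simp: p)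
    ultimately show "b \<in> box T d \<and> a \<in> (\<Union>k<w. ks (c k))" by (auto simp: in_keys_iff)
  qed
  then have "finite {(b, a). p b a \<noteq> 0}"
    by (rule finite_subset) (simp add: finite_box \<open>finite T\<close>)
  moreover have "(\<Sum>t\<le>s. p (b + sg i t) (a + sg i (s - t))) = 0"
    if i: "i \<in> T" and b: "lk b i = 0" and a: "lk a i = 0" for i b a s
  proof (cases "ks b \<subseteq> T")
    case True
    then have "ks b \<subseteq> T - {i}" using b by (auto simp: in_keys_iff)
    from van[OF i this] have "(\<Sum>t\<le>d. P (b + sg i t) * mvar i ^ t) = 0"
      by (simp add: P_def sum_distrib_left sum_distrib_right mult.assoc)
         (subst sum.swap, assumption)
    \<comment> \<open>As \<open>a\<close> does not involve \<open>i\<close>, this coefficient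
      collects the antidiagonal of degree \<open>s\<close>.\<close>
    from arg_cong[OF this, of "\<lambda>q. lk q (a + sg i s)"]
    have "(\<Sum>t\<le>d. lk (P (b + sg i t) * mvar i ^ t) (a + sg i s)) = 0"
      by (simp only: lookup_sum lookup_zero)
    moreover have "lk (P (b + sg i t) * mvar i ^ t) (a + sg i s) =
        (if t \<le> s then p (b + sg i t) (a + sg i (s - t)) else 0)" for t
    proof -
      have pow: "mvar i ^ t = (sg (sg i t) 1 :: ('v, 'a) mpoly)"
        using mconst_mult_mvar_power[of "1::'a" i t] by (simp add: mconst_def)
      show ?thesis
      proof (cases "t \<le> s")
        case True
        then have "(a + sg i (s - t)) + sg i t = a + sg i s"
          by (simp add: add.assoc flip: single_add)
        then show ?thesis
          using True lookup_mult_single_add[of "P (b + sg i t)" "sg i t" 1 "a + sg i (s - t)"]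
          by (simp only: pow p_def if_True mult_1_right)
      next
        case False
        have "l + sg i t \<noteq> a + sg i s" for l
        proof
          assume "l + sg i t = a + sg i s"
          from arg_cong[OF this, of "\<lambda>m. lk m i"] show False
            using False a by (simp add: lookup_add)
        qed
        then show ?thesis using False by (simp add: pow lookup_mult_single)
      qed
    qed
    ultimately have "(\<Sum>t\<le>d. if t \<le> s then p (b + sg i t) (a + sg i (s - t)) else 0) = 0" by simp
    \<comment> \<open>Exponents of \<open>i\<close> above \<open>d\<close> leave the box and
      contribute nothing.\<close>
    also have "(\<Sum>t\<le>d. if t \<le> s then p (b + sg i t) (a + sg i (s - t)) else 0) =
        (\<Sum>t\<le>s. p (b + sg i t) (a + sg i (s - t)))"
    proof (rule sum.mono_neutral_cong)
      fix t assume "t \<in> {..s} - {..d}"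
      then have "lk (b + sg i t) i > d" by (simp add: lookup_add)
      then have "b + sg i t \<notin> box T d" by (metis (no_types, lifting) box_def mem_Collect_eq leD)
      then show "p (b + sg i t) (a + sg i (s - t)) = 0" by (rule p0)
    qed auto
    finally show ?thesis .
  next
    case False
    have "b + sg i t \<notin> box T d" for t
      using False by (auto simp: box_def in_keys_iff lookup_add subset_iff)
    then show ?thesis using p0 by simp
  qed
  moreover have "\<exists>b a. p b a \<noteq> 0"
  proof -
    have "P b0 \<noteq> 0" using nz by (simp add: P_def)
    then show ?thesis unfolding p_def by (metis lookup_zero poly_mapping_eqI)
  qed
  ultimately obtain bs as where diag: "\<forall>i < 2 ^ card T. p (bs i) (as i) \<noteq> 0"
    and tri: "\<forall>i < 2 ^ card T. \<forall>j < (i::nat). p (bs i) (as j) = 0"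
    using triangular_system_of_vanishing[OF \<open>finite T\<close>, of p] by blast
  show ?thesis
    by (rule triangular_le_rank[where x = "\<lambda>i k. g k (bs i)" and y = "\<lambda>j k. lk (c k) (as j)"])
       (use diag tri in \<open>auto simp: p\<close>)
qed

text \<open>The \<open>l + 1\<close> summands of the point match the size of \<open>T'\<close>,
  which forces rank \<open>2 ^ (l + 1)\<close>; the other \<open>l\<close> summands ensure that a
  minimal free set is at least that large.\<close>

lemma commutative_roABP_hit_by_SSV_gen:
  fixes F :: "(nat, 'a::field) mpoly"
  assumes F: "commutative_roABP (2 ^ n) w F" and "w \<ge> 1" and d: "indiv_deg_le F d"
    and w: "w < 2 ^ (l + 1)" and "F \<noteq> 0"
  shows "msubst (SSV_gen n (l + 1 + l)) F \<noteq> (0 :: (gvar, 'a) mpoly)"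
proof
  assume zero: "msubst (SSV_gen n (l + 1 + l)) F = (0 :: (gvar, 'a) mpoly)"
  define \<alpha> :: "nat \<Rightarrow> (gvar, 'a) mpoly" where "\<alpha> = SSV_gen n (l + 1)"
  define B :: "nat set" where "B = {1..2 ^ n}"
  define C where "C T e = pcoeff mconst \<alpha> d (B - T) F e" for T e
  have box: "ks F \<subseteq> box B d"
    using commutative_roABP_keys[OF F] d by (auto simp: box_def B_def indiv_deg_le_def)
  let ?P = "\<lambda>T. T \<subseteq> B \<and> (\<exists>e. ks e \<subseteq> T \<and> C T e \<noteq> 0)"
  obtain m where m: "m \<in> ks F" using \<open>F \<noteq> 0\<close> by (metis keys_eq_empty ex_in_conv)
  \<comment> \<open>With all coordinates free nothing is substituted, so some free set
    exists.\<close>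
  have "C B m \<noteq> 0"
    using m by (simp add: C_def pcoeff_empty mconst_def in_keys_iff)
       (metis lookup_single_eq lookup_zero)
  moreover have "ks m \<subseteq> B" using m box by (auto simp: box_def)
  ultimately have "?P B" by blast
  then obtain T where T: "?P T" and least: "\<And>T'. ?P T' \<Longrightarrow> card T \<le> card T'"
    using ex_has_least_nat[of ?P B card] by blast
  then obtain e where TB: "T \<subseteq> B" and e: "ks e \<subseteq> T" "C T e \<noteq> 0" by blast
  have finT: "finite T" using TB finite_subset by (auto simp: B_def)
  have "\<not> card T \<le> l"
    using pcoeff_SSV_gen_eq_0[of F n d T l e "l + 1"] box TB e zero by (auto simp: B_def C_def \<alpha>_def)
  then obtain T' where T': "T' \<subseteq> T" "card T' = l + 1"
    using obtain_subset_with_card_n[of "l + 1" T] by auto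
  have T'B: "T' \<subseteq> B" using T' TB by blast
  obtain g h where gh: "\<And>b e. ks b \<subseteq> T' \<Longrightarrow> ks e \<subseteq> B - T' \<Longrightarrow>
      lk F (b + e) = (\<Sum>k<w. g k b * h k e)" and g0: "\<And>k b. b \<notin> box T' d \<Longrightarrow> g k b = 0"
    using commutative_roABP_rank_factorization[OF F \<open>w \<ge> 1\<close> T'B[unfolded B_def] d]
    unfolding B_def by blast
  \<comment> \<open>The exponents outside \<open>T'\<close> stay fixed at \<open>e1\<close> from
    here on; only the part in \<open>T'\<close> varies.\<close>
  define b1 where "b1 = mrestrict T' e"
  define e1 where "e1 = mrestrict (T - T') e"
  have e_eq: "b1 + e1 = e"
    unfolding b1_def e1_def using T' e by (intro mrestrict_add) auto
  have b1: "ks b1 \<subseteq> T'" and e1: "ks e1 \<subseteq> T - T'"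
    by (auto simp: b1_def e1_def keys_mrestrict)
  interpret mc: unital_hom "mconst :: 'a \<Rightarrow> (gvar, 'a) mpoly" by (rule unital_hom_mconst)
  \<comment> \<open>The coefficient at \<open>e1\<close> of the factor \<open>h k\<close> after the
    substitution outside \<open>T\<close>.\<close>
  define c where "c k = (\<Sum>u\<in>box (B - T) d. mconst (h k (e1 + u)) * mon_eval \<alpha> u)" for k
  have C: "C T (b + e1) = (\<Sum>k<w. c k * mconst (g k b))" if b: "ks b \<subseteq> T'" for b
  proof -
    have "lk F (b + e1 + u) = (\<Sum>k<w. g k b * h k (e1 + u))" if "u \<in> box (B - T) d" for u
    proof -
      have "ks (e1 + u) \<subseteq> B - T'"
        using that e1 T' TB Poly_Mapping.keys_add[of e1 u] unfolding box_def by blast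
      from gh[OF b this] show ?thesis by (simp add: add.assoc)
    qed
    then have "C T (b + e1) =
        (\<Sum>u\<in>box (B - T) d. \<Sum>k<w. mconst (h k (e1 + u)) * mon_eval \<alpha> u * mconst (g k b))"
      by (simp add: C_def pcoeff_def mc.hom_sum mc.hom_mult sum_distrib_left mult_ac)
    also have "\<dots> = (\<Sum>k<w. c k * mconst (g k b))"
      by (subst sum.swap) (simp add: c_def sum_distrib_right)
    finally show ?thesis .
  qed
  \<comment> \<open>Fresh variables outside \<open>T'\<close> make the evaluation injective on the
    whole polynomial ring.\<close>
  define \<gamma> where "\<gamma> i = (if i \<in> T' then SSV_gen n (l + 1) i
    else mvar (Y (l + 1 + 1 + i)) :: (gvar, 'a) mpoly)" for i
  let ?\<phi> = "meval mconst \<gamma>"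
  have "inj ?\<phi>" unfolding \<gamma>_def using T'B T'(2) by (intro SSV_gen_independent) (auto simp: B_def)
  have \<phi>: "unital_hom ?\<phi>" by (intro unital_hom_meval unital_hom_mconst)
  interpret \<phi>: unital_hom ?\<phi> by (rule \<phi>)
  note \<phi>_simps = meval_mconst[OF unital_hom_mconst] meval_mvar[OF unital_hom_mconst]
    \<phi>.hom_sum \<phi>.hom_mult \<phi>.hom_power
  \<comment> \<open>For \<open>i\<close> in \<open>T'\<close> and \<open>b\<close> free of
    \<open>i\<close>, its image under the evaluation is the coefficient at \<open>b\<close> of
    \<open>g k\<close> with \<alpha> substituted for the variable \<open>i\<close>.\<close>
  define vec :: "nat \<Rightarrow> (nat \<Rightarrow>\<^sub>0 nat) \<Rightarrow> nat \<Rightarrow> (nat, 'a) mpoly" where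
    "vec i b k = (\<Sum>t\<le>d. mconst (g k (b + sg i t)) * mvar i ^ t)" for i b k
  \<comment> \<open>By \<open>pcoeff_insert\<close> the sum is a coefficient of \<open>F\<close>
    with free set \<open>T - {i}\<close>, hence zero by minimality of \<open>T\<close>.\<close>
  have van: "(\<Sum>k<w. c k * ?\<phi> (vec i b k)) = 0" if i: "i \<in> T'" and b: "ks b \<subseteq> T' - {i}" for i b
  proof -
    have kb: "ks (b + sg i t) \<subseteq> T'" for t
      using i b Poly_Mapping.keys_add[of b "sg i t"] keys_single[of i t] by (auto split: if_splits)
    have "(\<Sum>k<w. c k * ?\<phi> (vec i b k)) = (\<Sum>k<w. \<Sum>t\<le>d. c k * mconst (g k (b + sg i t)) * \<alpha> i ^ t)"
      using i by (simp add: vec_def \<phi>_simps \<gamma>_def \<alpha>_def sum_distrib_left mult.assoc)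
    also have "\<dots> = (\<Sum>t\<le>d. C T (b + sg i t + e1) * \<alpha> i ^ t)"
      by (subst sum.swap) (simp add: C[OF kb] sum_distrib_right)
    also have "\<dots> = pcoeff mconst \<alpha> d (insert i (B - T)) F (b + e1)"
      using i T' by (subst pcoeff_insert) (auto simp: C_def add_ac)
    also have "insert i (B - T) = B - (T - {i})" using i T' TB by auto
    also have "pcoeff mconst \<alpha> d (B - (T - {i})) F (b + e1) = 0"
    proof (rule ccontr)
      assume "pcoeff mconst \<alpha> d (B - (T - {i})) F (b + e1) \<noteq> 0"
      moreover have "ks (b + e1) \<subseteq> T - {i}"
        using i b e1 T' Poly_Mapping.keys_add[of b e1] by blast
      ultimately have "?P (T - {i})" using TB by (auto simp: C_def)
      then have "card T \<le> card (T - {i})" by (rule least)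
      moreover have "card (T - {i}) < card T"
        using finT i T' by (intro card_Diff1_less) auto
      ultimately show False by simp
    qed
    finally show ?thesis .
  qed
  have "(\<Sum>k<w. c k * ?\<phi> (mconst (g k b1))) \<noteq> 0"
    using e C[OF b1] by (simp add: \<phi>_simps e_eq)
  moreover have "(\<Sum>k<w. c k * ?\<phi> (v k)) = 0" if "v \<in> {vec i b | i b. i \<in> T' \<and> ks b \<subseteq> T' - {i}}" for v
    using that van by auto
  \<comment> \<open>The multipliers \<open>c\<close> lie in the ring of the generator. Descent
    replaces them by multipliers in the ring whose variables stand for the values of \<gamma>, where
    the rank bound applies.\<close>
  ultimately obtain c' where
    c': "\<forall>v \<in> {vec i b | i b. i \<in> T' \<and> ks b \<subseteq> T' - {i}}. (\<Sum>k<w. c' k * v k) = 0"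
      "(\<Sum>k<w. c' k * mconst (g k b1)) \<noteq> 0"
    using solution_descends_to_subdomain[OF \<phi> \<open>inj ?\<phi>\<close>,
        where V = "{vec i b | i b. i \<in> T' \<and> ks b \<subseteq> T' - {i}}" and w = w and c = c
          and r = "\<lambda>k. mconst (g k b1)"] by blast
  have "2 ^ card T' \<le> w"
  proof (rule rank_bound_of_vanishing_combination[where d = d and g = g and c = c' and ?b0.0 = b1])
    show "finite T'" using T' finT finite_subset by blast
    show "(\<Sum>k<w. c' k * (\<Sum>t\<le>d. mconst (g k (b + sg i t)) * mvar i ^ t)) = 0"
      if "i \<in> T'" "ks b \<subseteq> T' - {i}" for i b
    proof -
      have "(\<Sum>k<w. c' k * vec i b k) = 0" using c'(1) that by auto
      then show ?thesis by (simp add: vec_def)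
    qed
  qed (use g0 c' in auto)
  with w T' show False by simp
qed

theorem theorem5p19:
  fixes n w d :: nat and F :: "(nat, 'a::field) mpoly"
  assumes "n \<ge> 1" and "w \<ge> 1" and "d \<ge> 1"
    and "infinite (UNIV :: 'a set) \<or> card (UNIV :: 'a set) > n * d"
    and "indiv_deg_le F d"
    and "commutative_roABP (2 ^ n) w F"
  shows "F \<noteq> 0 \<longleftrightarrow>
         msubst (SSV_gen n (1 + 4 * nat \<lceil>log 2 (real w)\<rceil>)) F \<noteq> (0 :: (gvar, 'a) mpoly)"
proof
  assume "F \<noteq> 0"
  define L where "L = nat \<lceil>log 2 (real w)\<rceil>"
  have "log 2 (real w) \<le> real L" unfolding L_def by (rule real_nat_ceiling_ge)
  then have "real w \<le> 2 powr real L" using \<open>w \<ge> 1\<close> by (simp add: log_le_iff)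
  then have "real w \<le> real (2 ^ L)" by (simp add: powr_realpow)
  then have "w \<le> 2 ^ L" by (simp only: of_nat_le_iff)
  also have "(2 :: nat) ^ L < 2 ^ (2 * L + 1)" by (intro power_strict_increasing) auto
  \<comment> \<open>Here \<open>l = 2 * L\<close>, which accounts for all \<open>1 + 4 * L\<close>
    summands.\<close>
  finally have "msubst (SSV_gen n (2 * L + 1 + 2 * L)) F \<noteq> (0 :: (gvar, 'a) mpoly)"
    using commutative_roABP_hit_by_SSV_gen assms \<open>F \<noteq> 0\<close> by blast
  also have "2 * L + 1 + 2 * L = 1 + 4 * L" by simp
  finally show "msubst (SSV_gen n (1 + 4 * nat \<lceil>log 2 (real w)\<rceil>)) F \<noteq> (0 :: (gvar, 'a) mpoly)"
    by (simp add: L_def)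
qed (auto simp: msubst_def)

end
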